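(* Let $\langle \mathsf B,\mathcal F\rangle$ be a display map category with $\mathcal F$-dependent coproducts, and $\mathsf p:\mathsf E\to\mathsf B$ a fibration with fibred coproducts along $\mathcal F$. Then $\mathsf p$ is a dependent Hilbert $\epsilon$-fibration if and only if for every object $\alpha\in\mathsf E_I$ and every display map $f:I\twoheadrightarrow J$ there uniquely exist an arrow $\epsilon_{\alpha,f}:J\to I$ and a vertical map $$\overline{\epsilon}_{\alpha,f}:\coprod_f\alpha\to(\epsilon_{\alpha,f})^*\alpha$$ such that: 1. $f\circ\epsilon_{\alpha,f}=\mathrm{id}_J$; 2. $\mathrm{id}=(\epsilon_{\alpha,f})^*\eta_\alpha\circ\overline{\epsilon}_{\alpha,f}$, where $\eta:\mathrm{id}_{\mathsf E_I}\Rightarrow f^*\coprod_f$ is the unit of the adjunction $\coprod_f\dashv f^*$; 3. whenever a vertical arrow $u:\gamma\to\coprod_g\beta$ (with $g:K\twoheadrightarrow L$ in $\mathcal F$, $\beta\in\mathsf E_K$, $\gamma\in\mathsf E_L$) admits a decomposition $u=t^*(\eta_\beta)\circ h$ for some section $t:L\to K$ of $g$ and some vertical arrow $h:\gamma\to t^*(\beta)$, where $\eta$ is the unit of $\coprod_g\dashv g^*$, then $t=\epsilon_{\beta,g}$ and $h=\overline{\epsilon}_{\beta,g}\circ u$.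
   Context: Fibrations $\mathsf p:\mathsf E\to\mathsf B$ are cloven Grothendieck fibrations; $\mathsf E_A$ is the fibre over $A$; vertical arrows are those over identities; $u^*$ is reindexing along $u$; canonical isomorphisms such as $g^*u^*\cong(ug)^*$ (in particular $t^*g^*\coprod_g\beta\cong\coprod_g\beta$ for a section $t$ of $g$) are suppressed. A display map category $\langle\mathsf B,\mathcal F\rangle$ is a category with a class $\mathcal F$ of morphisms (display maps, written $\twoheadrightarrow$) such that pullbacks of $\mathcal F$-maps along arbitrary maps exist and lie in $\mathcal F$. It has $\mathcal F$-dependent coproducts if $\mathcal F$ is closed under composition. $\mathsf p$ has fibred coproducts along $\mathcal F$ if for each $v\in\mathcal F$ the functor $v^*$ has a left adjoint $\coprod_v$ and, for every pullback square with $v:L\twoheadrightarrow J$, $f:I\to J$ arbitrary, $u:K\twoheadrightarrow I$, $g:K\to L$, the canonical map $\coprod_u g^*\Rightarrow f^*\coprod_v$ is an isomorphism (Beck–Chevalley). $\alpha\in\mathsf E_A$ is $(\mathcal F,\coprod)$-quantifier splitting if for every $u:B\twoheadrightarrow A$ in $\mathcal F$, every $\beta\in\mathsf E_B$ and every vertical $h:\alpha\to\coprod_u\beta$ there exist a unique section $g:A\to B$ of $u$ and a unique vertical $\overline h:\alpha\to g^*\beta$ with $h=g^*(\eta_\beta)\circ\overline h$, where $\eta$ is the unit of $\coprod_u\dashv u^*$. It is $(\mathcal F,\coprod)$-quantifier-free if $f^*\alpha$ is $(\mathcal F,\coprod)$-quantifier splitting for every $f:I\to A$ in $\mathsf B$.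 $\mathsf p$ is a dependent Hilbert $\epsilon$-fibration if $\langle\mathsf B,\mathcal F\rangle$ has $\mathcal F$-dependent coproducts, $\mathsf p$ has fibred coproducts along $\mathcal F$, and every object of $\mathsf E$ is $(\mathcal F,\coprod)$-quantifier-free. *)

theory Defs
  imports Main
begin

section \<open>Categories, functors, adjunctions\<close>

record ('o, 'a) cat =
  obj :: "'o set"
  arr :: "'a set"
  src :: "'a \<Rightarrow> 'o"
  tgt :: "'a \<Rightarrow> 'o"
  ident :: "'o \<Rightarrow> 'a"
  comp :: "'a \<Rightarrow> 'a \<Rightarrow> 'a" (infixl "\<cdot>\<index>" 70)

definition hom :: "('o, 'a) cat \<Rightarrow> 'o \<Rightarrow> 'o \<Rightarrow> 'a set" where
  "hom C A B = {f \<in> arr C. src C f = A \<and> tgt C f = B}"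

locale category =
  fixes C :: "('o, 'a) cat" (structure)
  assumes src_obj: "f \<in> arr C \<Longrightarrow> src C f \<in> obj C"
    and tgt_obj: "f \<in> arr C \<Longrightarrow> tgt C f \<in> obj C"
    and ident_hom: "A \<in> obj C \<Longrightarrow> ident C A \<in> hom C A A"
    and comp_hom: "\<lbrakk>f \<in> hom C A B; g \<in> hom C B D\<rbrakk> \<Longrightarrow> g \<cdot> f \<in> hom C A D"
    and comp_ident: "f \<in> hom C A B \<Longrightarrow> f \<cdot> ident C A = f"
    and ident_comp: "f \<in> hom C A B \<Longrightarrow> ident C B \<cdot> f = f"
    and comp_assoc: "\<lbrakk>f \<in> hom C A B; g \<in> hom C B D; h \<in> hom C D D'\<rbrakk>
      \<Longrightarrow> (h \<cdot> g) \<cdot> f = h \<cdot> (g \<cdot> f)"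

definition is_inverse :: "('o, 'a) cat \<Rightarrow> 'a \<Rightarrow> 'a \<Rightarrow> bool" where
  "is_inverse C f g \<longleftrightarrow> f \<in> arr C \<and> g \<in> hom C (tgt C f) (src C f)
     \<and> g \<cdot>\<^bsub>C\<^esub> f = ident C (src C f) \<and> f \<cdot>\<^bsub>C\<^esub> g = ident C (tgt C f)"

definition is_iso :: "('o, 'a) cat \<Rightarrow> 'a \<Rightarrow> bool" where
  "is_iso C f \<longleftrightarrow> (\<exists>g. is_inverse C f g)"

definition inverse_arr :: "('o, 'a) cat \<Rightarrow> 'a \<Rightarrow> 'a" where
  "inverse_arr C f = (THE g. is_inverse C f g)"

definition is_section :: "('o, 'a) cat \<Rightarrow> 'a \<Rightarrow> 'a \<Rightarrow> bool" where
  "is_section C u g \<longleftrightarrow> g \<in> hom C (tgt C u) (src C u) \<and> u \<cdot>\<^bsub>C\<^esub> g = ident C (tgt C u)"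

text \<open>\<open>is_pullback C v f g u\<close>: the square \<open>v \<cdot> g = f \<cdot> u\<close> is a pullback, so that \<open>u\<close> is
  a pullback of \<open>v\<close> along \<open>f\<close>.\<close>

definition is_pullback :: "('o, 'a) cat \<Rightarrow> 'a \<Rightarrow> 'a \<Rightarrow> 'a \<Rightarrow> 'a \<Rightarrow> bool" where
  "is_pullback C v f g u \<longleftrightarrow>
     v \<in> arr C \<and> f \<in> arr C \<and> tgt C v = tgt C f
     \<and> g \<in> hom C (src C u) (src C v) \<and> u \<in> hom C (src C u) (src C f)
     \<and> v \<cdot>\<^bsub>C\<^esub> g = f \<cdot>\<^bsub>C\<^esub> u
     \<and> (\<forall>X\<in>obj C. \<forall>a\<in>hom C X (src C v). \<forall>b\<in>hom C X (src C f). v \<cdot>\<^bsub>C\<^esub> a = f \<cdot>\<^bsub>C\<^esub> b \<longrightarrow>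
          (\<exists>!k. k \<in> hom C X (src C u) \<and> g \<cdot>\<^bsub>C\<^esub> k = a \<and> u \<cdot>\<^bsub>C\<^esub> k = b))"

record ('o, 'a, 'p, 'b) ftor =
  on_obj :: "'o \<Rightarrow> 'p"
  on_arr :: "'a \<Rightarrow> 'b"

locale is_functor = C: category C + D: category D
  for C :: "('o, 'a) cat" and D :: "('p, 'b) cat" +
  fixes G :: "('o, 'a, 'p, 'b) ftor"
  assumes on_obj_obj: "A \<in> obj C \<Longrightarrow> on_obj G A \<in> obj D"
    and on_arr_hom: "f \<in> hom C A B \<Longrightarrow> on_arr G f \<in> hom D (on_obj G A) (on_obj G B)"
    and on_arr_ident: "A \<in> obj C \<Longrightarrow> on_arr G (ident C A) = ident D (on_obj G A)"
    and on_arr_comp: "\<lbrakk>f \<in> hom C A B; g \<in> hom C B X\<rbrakk>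
      \<Longrightarrow> on_arr G (g \<cdot>\<^bsub>C\<^esub> f) = on_arr G g \<cdot>\<^bsub>D\<^esub> on_arr G f"

definition id_ftor :: "('o, 'a, 'o, 'a) ftor" where
  "id_ftor = \<lparr>on_obj = (\<lambda>A. A), on_arr = (\<lambda>f. f)\<rparr>"

definition comp_ftor ::
  "('p, 'b, 'q, 'c) ftor \<Rightarrow> ('o, 'a, 'p, 'b) ftor \<Rightarrow> ('o, 'a, 'q, 'c) ftor" where
  "comp_ftor G H =
     \<lparr>on_obj = (\<lambda>A. on_obj G (on_obj H A)), on_arr = (\<lambda>f. on_arr G (on_arr H f))\<rparr>"

locale nat_trans = G: is_functor C D G + H: is_functor C D H
  for C :: "('o, 'a) cat" and D :: "('p, 'b) cat"
    and G H :: "('o, 'a, 'p, 'b) ftor" +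
  fixes \<tau> :: "'o \<Rightarrow> 'b"
  assumes component: "A \<in> obj C \<Longrightarrow> \<tau> A \<in> hom D (on_obj G A) (on_obj H A)"
    and natural: "f \<in> hom C A B \<Longrightarrow> \<tau> B \<cdot>\<^bsub>D\<^esub> on_arr G f = on_arr H f \<cdot>\<^bsub>D\<^esub> \<tau> A"

locale adjunction = L: is_functor C D L + R: is_functor D C R
    + unit: nat_trans C C id_ftor "comp_ftor R L" \<eta>
    + counit: nat_trans D D "comp_ftor L R" id_ftor \<theta>
  for C :: "('o, 'a) cat" and D :: "('p, 'b) cat"
    and L :: "('o, 'a, 'p, 'b) ftor" and R :: "('p, 'b, 'o, 'a) ftor"
    and \<eta> :: "'o \<Rightarrow> 'a" and \<theta> :: "'p \<Rightarrow> 'b" +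
  assumes triangle_left:
      "A \<in> obj C \<Longrightarrow> \<theta> (on_obj L A) \<cdot>\<^bsub>D\<^esub> on_arr L (\<eta> A) = ident D (on_obj L A)"
    and triangle_right:
      "X \<in> obj D \<Longrightarrow> on_arr R (\<theta> X) \<cdot>\<^bsub>C\<^esub> \<eta> (on_obj R X) = ident C (on_obj R X)"

section \<open>Cloven fibrations\<close>

text \<open>The cleavage \<open>lift P u \<alpha>\<close> is the chosen cartesian arrow \<open>u\<^sup>*\<alpha> \<rightarrow> \<alpha>\<close> over \<open>u\<close>. It is not
  assumed to be normal or split.\<close>

record ('eo, 'ea, 'bo, 'ba) fibration_data =
  tot :: "('eo, 'ea) cat"
  base :: "('bo, 'ba) cat"
  proj :: "('eo, 'ea, 'bo, 'ba) ftor"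
  lift :: "'ba \<Rightarrow> 'eo \<Rightarrow> 'ea"

definition is_factor ::
  "('eo, 'ea, 'bo, 'ba) fibration_data \<Rightarrow> 'ea \<Rightarrow> 'ea \<Rightarrow> 'ba \<Rightarrow> 'ea \<Rightarrow> bool" where
  "is_factor P f k w h \<longleftrightarrow>
     h \<in> hom (tot P) (src (tot P) k) (src (tot P) f)
     \<and> on_arr (proj P) h = w \<and> f \<cdot>\<^bsub>tot P\<^esub> h = k"

definition cartesian :: "('eo, 'ea, 'bo, 'ba) fibration_data \<Rightarrow> 'ea \<Rightarrow> bool" where
  "cartesian P f \<longleftrightarrow> f \<in> arr (tot P) \<and>
     (\<forall>k\<in>arr (tot P). tgt (tot P) k = tgt (tot P) f \<longrightarrow>
       (\<forall>w\<in>hom (base P) (on_obj (proj P) (src (tot P) k)) (on_obj (proj P) (src (tot P) f)).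
          on_arr (proj P) k = on_arr (proj P) f \<cdot>\<^bsub>base P\<^esub> w \<longrightarrow> (\<exists>!h. is_factor P f k w h)))"

text \<open>The factorization of \<open>k\<close> over \<open>w\<close> through the cartesian arrow \<open>f\<close>.\<close>

definition factor :: "('eo, 'ea, 'bo, 'ba) fibration_data \<Rightarrow> 'ea \<Rightarrow> 'ea \<Rightarrow> 'ba \<Rightarrow> 'ea" where
  "factor P f k w = (THE h. is_factor P f k w h)"

definition cloven_fibration :: "('eo, 'ea, 'bo, 'ba) fibration_data \<Rightarrow> bool" where
  "cloven_fibration P \<longleftrightarrow>
     category (tot P) \<and> category (base P) \<and> is_functor (tot P) (base P) (proj P) \<and>
     (\<forall>u\<in>arr (base P). \<forall>\<alpha>\<in>obj (tot P). on_obj (proj P) \<alpha> = tgt (base P) u \<longrightarrow>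
        lift P u \<alpha> \<in> arr (tot P) \<and> tgt (tot P) (lift P u \<alpha>) = \<alpha>
        \<and> on_arr (proj P) (lift P u \<alpha>) = u \<and> cartesian P (lift P u \<alpha>))"

text \<open>Vertical arrows over \<open>A\<close> are the arrows of \<open>fibre P A\<close>.\<close>

definition fibre :: "('eo, 'ea, 'bo, 'ba) fibration_data \<Rightarrow> 'bo \<Rightarrow> ('eo, 'ea) cat" where
  "fibre P A =
     \<lparr>obj = {\<alpha> \<in> obj (tot P). on_obj (proj P) \<alpha> = A},
      arr = {h \<in> arr (tot P). on_arr (proj P) h = ident (base P) A
               \<and> on_obj (proj P) (src (tot P) h) = A \<and> on_obj (proj P) (tgt (tot P) h) = A},
      src = src (tot P), tgt = tgt (tot P), ident = ident (tot P), comp = comp (tot P)\<rparr>"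

definition reindex ::
  "('eo, 'ea, 'bo, 'ba) fibration_data \<Rightarrow> 'ba \<Rightarrow> ('eo, 'ea, 'eo, 'ea) ftor" where
  "reindex P u =
     \<lparr>on_obj = (\<lambda>\<alpha>. src (tot P) (lift P u \<alpha>)),
      on_arr = (\<lambda>h. factor P (lift P u (tgt (tot P) h))
                      (h \<cdot>\<^bsub>tot P\<^esub> lift P u (src (tot P) h)) (ident (base P) (src (base P) u)))\<rparr>"

text \<open>The canonical isomorphism \<open>g\<^sup>*u\<^sup>*\<alpha> \<rightarrow> (u \<cdot> g)\<^sup>*\<alpha>\<close>. The canonical isomorphism
  \<open>(ident A)\<^sup>*\<alpha> \<rightarrow> \<alpha>\<close> is \<open>lift P (ident A) \<alpha>\<close> itself.\<close>

definition reindex_comp_iso ::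
  "('eo, 'ea, 'bo, 'ba) fibration_data \<Rightarrow> 'ba \<Rightarrow> 'ba \<Rightarrow> 'eo \<Rightarrow> 'ea" where
  "reindex_comp_iso P u g \<alpha> =
     factor P (lift P (u \<cdot>\<^bsub>base P\<^esub> g) \<alpha>)
       (lift P u \<alpha> \<cdot>\<^bsub>tot P\<^esub> lift P g (on_obj (reindex P u) \<alpha>)) (ident (base P) (src (base P) g))"

text \<open>For a section \<open>t\<close> of \<open>g\<close>, the canonical isomorphism
  \<open>t\<^sup>*g\<^sup>*\<alpha> \<cong> (g \<cdot> t)\<^sup>*\<alpha> = (ident (tgt g))\<^sup>*\<alpha> \<cong> \<alpha>\<close>.\<close>

definition section_iso ::
  "('eo, 'ea, 'bo, 'ba) fibration_data \<Rightarrow> 'ba \<Rightarrow> 'ba \<Rightarrow> 'eo \<Rightarrow> 'ea" where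
  "section_iso P g t \<alpha> =
     lift P (ident (base P) (tgt (base P) g)) \<alpha> \<cdot>\<^bsub>tot P\<^esub> reindex_comp_iso P g t \<alpha>"

section \<open>Display maps and fibred coproducts\<close>

text \<open>Pullbacks being determined only up to isomorphism, every pullback of a display map is
  required to be a display map.\<close>

definition display_map_category :: "('bo, 'ba) cat \<Rightarrow> 'ba set \<Rightarrow> bool" where
  "display_map_category B F \<longleftrightarrow> category B \<and> F \<subseteq> arr B \<and>
     (\<forall>v\<in>F. \<forall>f\<in>arr B. tgt B f = tgt B v \<longrightarrow>
        (\<exists>g u. is_pullback B v f g u) \<and> (\<forall>g u. is_pullback B v f g u \<longrightarrow> u \<in> F))"

definition has_dependent_coproducts :: "('bo, 'ba) cat \<Rightarrow> 'ba set \<Rightarrow> bool" where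
  "has_dependent_coproducts B F \<longleftrightarrow>
     (\<forall>u\<in>F. \<forall>v\<in>F. tgt B u = src B v \<longrightarrow> v \<cdot>\<^bsub>B\<^esub> u \<in> F)"

text \<open>A choice of adjunctions \<open>\<Coprod>\<^sub>v \<stileturn> v\<^sup>*\<close>.\<close>

record ('eo, 'ea, 'ba) coprod_data =
  coprod :: "'ba \<Rightarrow> ('eo, 'ea, 'eo, 'ea) ftor"
  coprod_unit :: "'ba \<Rightarrow> 'eo \<Rightarrow> 'ea"
  coprod_counit :: "'ba \<Rightarrow> 'eo \<Rightarrow> 'ea"

text \<open>For \<open>v \<cdot> g = f \<cdot> u\<close>, the component at \<open>\<beta>\<close> of the canonical map \<open>\<Coprod>\<^sub>u g\<^sup>* \<Rightarrow> f\<^sup>* \<Coprod>\<^sub>v\<close>: the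
  transpose under \<open>\<Coprod>\<^sub>u \<stileturn> u\<^sup>*\<close> of
  \<open>g\<^sup>*\<beta> \<rightarrow> g\<^sup>*v\<^sup>*\<Coprod>\<^sub>v \<beta> \<cong> (v \<cdot> g)\<^sup>*\<Coprod>\<^sub>v \<beta> = (f \<cdot> u)\<^sup>*\<Coprod>\<^sub>v \<beta> \<cong> u\<^sup>*f\<^sup>*\<Coprod>\<^sub>v \<beta>\<close>.\<close>

definition beck_chevalley_map ::
  "('eo, 'ea, 'bo, 'ba) fibration_data \<Rightarrow> ('eo, 'ea, 'ba) coprod_data
     \<Rightarrow> 'ba \<Rightarrow> 'ba \<Rightarrow> 'ba \<Rightarrow> 'ba \<Rightarrow> 'eo \<Rightarrow> 'ea" where
  "beck_chevalley_map P Q v f g u \<beta> =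
     (let X = on_obj (coprod Q v) \<beta>;
          m = inverse_arr (fibre P (src (base P) u)) (reindex_comp_iso P f u X)
                \<cdot>\<^bsub>tot P\<^esub> (reindex_comp_iso P v g X
                \<cdot>\<^bsub>tot P\<^esub> on_arr (reindex P g) (coprod_unit Q v \<beta>))
      in coprod_counit Q u (on_obj (reindex P f) X) \<cdot>\<^bsub>tot P\<^esub> on_arr (coprod Q u) m)"

definition fibred_coproducts ::
  "('eo, 'ea, 'bo, 'ba) fibration_data \<Rightarrow> 'ba set \<Rightarrow> ('eo, 'ea, 'ba) coprod_data \<Rightarrow> bool" where
  "fibred_coproducts P F Q \<longleftrightarrow>
     (\<forall>v\<in>F. adjunction (fibre P (src (base P) v)) (fibre P (tgt (base P) v))
               (coprod Q v) (reindex P v) (coprod_unit Q v) (coprod_counit Q v)) \<and>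
     (\<forall>v\<in>F. \<forall>u\<in>F. \<forall>f g. is_pullback (base P) v f g u \<longrightarrow>
        (\<forall>\<beta>\<in>obj (fibre P (src (base P) v)).
           is_iso (fibre P (tgt (base P) u)) (beck_chevalley_map P Q v f g u \<beta>)))"

section \<open>Dependent Hilbert epsilon-fibrations\<close>

text \<open>For a section \<open>t\<close> of \<open>g\<close>, the arrow \<open>t\<^sup>*(\<eta>\<^sub>\<beta>)\<close> regarded as an arrow \<open>t\<^sup>*\<beta> \<rightarrow> \<Coprod>\<^sub>g \<beta>\<close> along
  the canonical isomorphism \<open>t\<^sup>*g\<^sup>*\<Coprod>\<^sub>g \<beta> \<cong> \<Coprod>\<^sub>g \<beta>\<close>.\<close>

definition section_unit ::
  "('eo, 'ea, 'bo, 'ba) fibration_data \<Rightarrow> ('eo, 'ea, 'ba) coprod_data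
     \<Rightarrow> 'ba \<Rightarrow> 'ba \<Rightarrow> 'eo \<Rightarrow> 'ea" where
  "section_unit P Q g t \<beta> =
     section_iso P g t (on_obj (coprod Q g) \<beta>)
       \<cdot>\<^bsub>tot P\<^esub> on_arr (reindex P t) (coprod_unit Q g \<beta>)"

definition quantifier_splitting ::
  "('eo, 'ea, 'bo, 'ba) fibration_data \<Rightarrow> 'ba set \<Rightarrow> ('eo, 'ea, 'ba) coprod_data
     \<Rightarrow> 'bo \<Rightarrow> 'eo \<Rightarrow> bool" where
  "quantifier_splitting P F Q A \<alpha> \<longleftrightarrow>
     (\<forall>u\<in>F. tgt (base P) u = A \<longrightarrow>
       (\<forall>\<beta>\<in>obj (fibre P (src (base P) u)). \<forall>h\<in>hom (fibre P A) \<alpha> (on_obj (coprod Q u) \<beta>).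
          \<exists>!d. case d of (g, h') \<Rightarrow>
            is_section (base P) u g
            \<and> h' \<in> hom (fibre P A) \<alpha> (on_obj (reindex P g) \<beta>)
            \<and> h = section_unit P Q u g \<beta> \<cdot>\<^bsub>tot P\<^esub> h'))"

definition quantifier_free ::
  "('eo, 'ea, 'bo, 'ba) fibration_data \<Rightarrow> 'ba set \<Rightarrow> ('eo, 'ea, 'ba) coprod_data
     \<Rightarrow> 'bo \<Rightarrow> 'eo \<Rightarrow> bool" where
  "quantifier_free P F Q A \<alpha> \<longleftrightarrow>
     (\<forall>f\<in>arr (base P). tgt (base P) f = A \<longrightarrow>
        quantifier_splitting P F Q (src (base P) f) (on_obj (reindex P f) \<alpha>))"

definition dependent_Hilbert_epsilon_fibration ::
  "('eo, 'ea, 'bo, 'ba) fibration_data \<Rightarrow> 'ba set \<Rightarrow> ('eo, 'ea, 'ba) coprod_data \<Rightarrow> bool" where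
  "dependent_Hilbert_epsilon_fibration P F Q \<longleftrightarrow>
     cloven_fibration P \<and> display_map_category (base P) F
     \<and> has_dependent_coproducts (base P) F \<and> fibred_coproducts P F Q
     \<and> (\<forall>A\<in>obj (base P). \<forall>\<alpha>\<in>obj (fibre P A). quantifier_free P F Q A \<alpha>)"

text \<open>\<open>\<epsilon> \<alpha> f\<close> and \<open>\<epsilon>' \<alpha> f\<close> are the arrows \<open>\<epsilon>\<^sub>\<alpha>\<^sub>,\<^sub>f : J \<rightarrow> I\<close> and \<open>\<Coprod>\<^sub>f \<alpha> \<rightarrow> (\<epsilon>\<^sub>\<alpha>\<^sub>,\<^sub>f)\<^sup>*\<alpha>\<close>. The last
  condition at \<open>(\<beta>, g)\<close> refers to the values of the family at \<open>(\<beta>, g)\<close>, which is why the conditions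
  are imposed on a whole family; values outside the indices \<open>(\<alpha>, f)\<close> with \<open>f \<in> F\<close> and \<open>\<alpha>\<close> over
  \<open>src f\<close> are irrelevant.\<close>

definition epsilon_family ::
  "('eo, 'ea, 'bo, 'ba) fibration_data \<Rightarrow> 'ba set \<Rightarrow> ('eo, 'ea, 'ba) coprod_data
     \<Rightarrow> ('eo \<Rightarrow> 'ba \<Rightarrow> 'ba) \<Rightarrow> ('eo \<Rightarrow> 'ba \<Rightarrow> 'ea) \<Rightarrow> bool" where
  "epsilon_family P F Q \<epsilon> \<epsilon>' \<longleftrightarrow>
     (\<forall>f\<in>F. \<forall>\<alpha>\<in>obj (fibre P (src (base P) f)).
        \<epsilon> \<alpha> f \<in> hom (base P) (tgt (base P) f) (src (base P) f)
        \<and> \<epsilon>' \<alpha> f \<in> hom (fibre P (tgt (base P) f))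
                       (on_obj (coprod Q f) \<alpha>) (on_obj (reindex P (\<epsilon> \<alpha> f)) \<alpha>)
        \<and> f \<cdot>\<^bsub>base P\<^esub> \<epsilon> \<alpha> f = ident (base P) (tgt (base P) f)
        \<and> ident (tot P) (on_obj (coprod Q f) \<alpha>)
            = section_unit P Q f (\<epsilon> \<alpha> f) \<alpha> \<cdot>\<^bsub>tot P\<^esub> \<epsilon>' \<alpha> f) \<and>
     (\<forall>g\<in>F. \<forall>\<beta>\<in>obj (fibre P (src (base P) g)). \<forall>\<gamma>\<in>obj (fibre P (tgt (base P) g)).
        \<forall>u\<in>hom (fibre P (tgt (base P) g)) \<gamma> (on_obj (coprod Q g) \<beta>). \<forall>t h.
          is_section (base P) g t
          \<and> h \<in> hom (fibre P (tgt (base P) g)) \<gamma> (on_obj (reindex P t) \<beta>)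
          \<and> u = section_unit P Q g t \<beta> \<cdot>\<^bsub>tot P\<^esub> h
          \<longrightarrow> t = \<epsilon> \<beta> g \<and> h = \<epsilon>' \<beta> g \<cdot>\<^bsub>tot P\<^esub> u)"

end

theory Submission
  imports Defs
begin

text \<open>Reindexing along an identity is isomorphic to the identity, so every object is
  quantifier-free iff every object is quantifier splitting. Splitting the identity of \<open>\<Coprod>\<^sub>f \<alpha>\<close>
  yields \<open>\<epsilon>\<^sub>\<alpha>\<^sub>,\<^sub>f\<close> and its vertical map; a vertical \<open>u : \<gamma> \<rightarrow> \<Coprod>\<^sub>f \<alpha>\<close> is then split by precomposing
  that splitting with \<open>u\<close>, and the third condition says that this is the only splitting of \<open>u\<close>.
  Two families agree because the third condition of one applies to the identities split by the
  other.\<close>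

text \<open>Splittings are unique as pairs \<open>d\<close> of a section and a vertical arrow; the
  curried form lets existence and uniqueness be argued without tuples.\<close>

lemma ex1_pair_iff:
  "(\<exists>!d. case d of (x, y) \<Rightarrow> R x y) \<longleftrightarrow>
    (\<exists>x y. R x y \<and> (\<forall>x' y'. R x' y' \<longrightarrow> x' = x \<and> y' = y))"
  unfolding Ex1_def split_paired_Ex split_paired_All by simp

lemma (in category) hom_objs:
  assumes "f \<in> hom C A B"
  shows "A \<in> obj C" "B \<in> obj C"
  using assms src_obj tgt_obj by (auto simp: hom_def)

text \<open>A fibre inherits composition and identities from \<open>tot P\<close>, so equations are
  computed there and only verticality has to be tracked.\<close>

lemma hom_fibre_iff:
  "h \<in> hom (fibre P A) \<alpha> \<beta> \<longleftrightarrow> h \<in> hom (tot P) \<alpha> \<beta> \<and> on_arr (proj P) h = ident (base P) A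
     \<and> on_obj (proj P) \<alpha> = A \<and> on_obj (proj P) \<beta> = A"
  by (auto simp: hom_def fibre_def)

lemma obj_fibre_iff:
  "\<alpha> \<in> obj (fibre P A) \<longleftrightarrow> \<alpha> \<in> obj (tot P) \<and> on_obj (proj P) \<alpha> = A"
  by (simp add: fibre_def)

section \<open>Vertical factorization through the chosen cartesian lifts\<close>

context
  fixes P :: "('eo, 'ea, 'bo, 'ba) fibration_data"
  assumes cloven: "cloven_fibration P"
begin

interpretation p: is_functor "tot P" "base P" "proj P"
  using cloven by (simp add: cloven_fibration_def)

lemma lift_hom:
  assumes "u \<in> arr (base P)" "\<alpha> \<in> obj (fibre P (tgt (base P) u))"
  shows "lift P u \<alpha> \<in> hom (tot P) (on_obj (reindex P u) \<alpha>) \<alpha>"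
  using assms cloven by (auto simp: cloven_fibration_def obj_fibre_iff hom_def reindex_def)

lemma proj_lift:
  assumes "u \<in> arr (base P)" "\<alpha> \<in> obj (fibre P (tgt (base P) u))"
  shows "on_arr (proj P) (lift P u \<alpha>) = u"
  using assms cloven by (auto simp: cloven_fibration_def obj_fibre_iff)

lemma cartesian_lift:
  assumes "u \<in> arr (base P)" "\<alpha> \<in> obj (fibre P (tgt (base P) u))"
  shows "cartesian P (lift P u \<alpha>)"
  using assms cloven by (auto simp: cloven_fibration_def obj_fibre_iff)

lemma reindex_obj:
  assumes "u \<in> arr (base P)" "\<alpha> \<in> obj (fibre P (tgt (base P) u))"
  shows "on_obj (reindex P u) \<alpha> \<in> obj (fibre P (src (base P) u))"
  using lift_hom[OF assms] proj_lift[OF assms] p.on_arr_hom[OF lift_hom[OF assms]]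
    p.C.hom_objs(1)[OF lift_hom[OF assms]]
  by (auto simp: obj_fibre_iff hom_def)

text \<open>This is cartesianness of the lift, taken at the identity of the source: an arrow
  \<open>k\<close> over \<open>u\<close> also lies over \<open>u\<close> composed with that
  identity.\<close>

lemma lift_factor_unique:
  assumes "u \<in> arr (base P)" "\<alpha> \<in> obj (fibre P (tgt (base P) u))"
    and "k \<in> hom (tot P) \<gamma> \<alpha>" "\<gamma> \<in> obj (fibre P (src (base P) u))" "on_arr (proj P) k = u"
  shows "\<exists>!h. is_factor P (lift P u \<alpha>) k (ident (base P) (src (base P) u)) h"
proof -
  let ?A = "src (base P) u"
  have id: "ident (base P) ?A \<in> hom (base P) ?A ?A"
    using assms(1) by (simp add: p.D.src_obj p.D.ident_hom)
  have l: "lift P u \<alpha> \<in> hom (tot P) (on_obj (reindex P u) \<alpha>) \<alpha>"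
    using assms by (simp add: lift_hom)
  have "u \<cdot>\<^bsub>base P\<^esub> ident (base P) ?A = u"
    using assms(1) p.D.comp_ident by (auto simp: hom_def)
  then show ?thesis
    using cartesian_lift[OF assms(1,2)] assms(3-5) proj_lift[OF assms(1,2)] id l
      reindex_obj[OF assms(1,2)]
    by (auto simp: cartesian_def hom_def obj_fibre_iff)
qed

text \<open>Unique existence makes the \<open>THE\<close> in \<open>factor\<close> denote a genuine
  factorization, and lying over an identity makes it vertical.\<close>

lemma factor_lift_hom:
  assumes "u \<in> arr (base P)" "\<alpha> \<in> obj (fibre P (tgt (base P) u))"
    and "k \<in> hom (tot P) \<gamma> \<alpha>" "\<gamma> \<in> obj (fibre P (src (base P) u))" "on_arr (proj P) k = u"
  shows "factor P (lift P u \<alpha>) k (ident (base P) (src (base P) u))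
    \<in> hom (fibre P (src (base P) u)) \<gamma> (on_obj (reindex P u) \<alpha>)"
proof -
  have "is_factor P (lift P u \<alpha>) k (ident (base P) (src (base P) u))
    (factor P (lift P u \<alpha>) k (ident (base P) (src (base P) u)))"
    unfolding factor_def by (rule theI'[OF lift_factor_unique[OF assms]])
  moreover have "src (tot P) (lift P u \<alpha>) = on_obj (reindex P u) \<alpha>" "src (tot P) k = \<gamma>"
    using lift_hom[OF assms(1,2)] assms(3) by (auto simp: hom_def)
  ultimately show ?thesis
    using reindex_obj[OF assms(1,2)] assms(4)
    by (auto simp: hom_fibre_iff is_factor_def obj_fibre_iff)
qed

section \<open>Calculus of vertical arrows\<close>

lemma fibre_hom_objs:
  assumes "h \<in> hom (fibre P A) \<alpha> \<beta>"
  shows "\<alpha> \<in> obj (fibre P A)" "\<beta> \<in> obj (fibre P A)"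
  using assms p.C.hom_objs by (auto simp: hom_fibre_iff obj_fibre_iff)

lemma fibre_base_obj:
  assumes "\<alpha> \<in> obj (fibre P A)"
  shows "A \<in> obj (base P)"
  using assms p.on_obj_obj by (auto simp: obj_fibre_iff)

lemma fibre_comp_hom:
  assumes "f \<in> hom (fibre P A) \<alpha> \<beta>" "g \<in> hom (fibre P A) \<beta> \<gamma>"
  shows "g \<cdot>\<^bsub>tot P\<^esub> f \<in> hom (fibre P A) \<alpha> \<gamma>"
proof -
  have "ident (base P) A \<in> hom (base P) A A"
    using assms(1) by (metis fibre_hom_objs(1) fibre_base_obj p.D.ident_hom)
  then have "ident (base P) A \<cdot>\<^bsub>base P\<^esub> ident (base P) A = ident (base P) A"
    by (rule p.D.comp_ident)
  then show ?thesis
    using assms p.C.comp_hom p.on_arr_comp by (auto simp: hom_fibre_iff)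
qed

lemma fibre_comp_assoc:
  assumes "f \<in> hom (fibre P A) \<alpha> \<beta>" "g \<in> hom (fibre P A) \<beta> \<gamma>" "h \<in> hom (fibre P A) \<gamma> \<delta>"
  shows "(h \<cdot>\<^bsub>tot P\<^esub> g) \<cdot>\<^bsub>tot P\<^esub> f = h \<cdot>\<^bsub>tot P\<^esub> (g \<cdot>\<^bsub>tot P\<^esub> f)"
  using assms p.C.comp_assoc by (auto simp: hom_fibre_iff)

lemma fibre_ident_hom:
  assumes "\<alpha> \<in> obj (fibre P A)"
  shows "ident (tot P) \<alpha> \<in> hom (fibre P A) \<alpha> \<alpha>"
  using assms p.C.ident_hom p.on_arr_ident by (auto simp: hom_fibre_iff obj_fibre_iff)

lemma fibre_comp_ident:
  assumes "f \<in> hom (fibre P A) \<alpha> \<beta>"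
  shows "f \<cdot>\<^bsub>tot P\<^esub> ident (tot P) \<alpha> = f" "ident (tot P) \<beta> \<cdot>\<^bsub>tot P\<^esub> f = f"
  using assms p.C.comp_ident p.C.ident_comp by (auto simp: hom_fibre_iff)

section \<open>Typing of reindexing and of its canonical comparison arrows\<close>

lemma reindex_hom:
  assumes u: "u \<in> arr (base P)" and h: "h \<in> hom (fibre P (tgt (base P) u)) \<alpha> \<beta>"
  shows "on_arr (reindex P u) h
    \<in> hom (fibre P (src (base P) u)) (on_obj (reindex P u) \<alpha>) (on_obj (reindex P u) \<beta>)"
proof -
  note objs = fibre_hom_objs[OF h]
  have hE: "h \<in> hom (tot P) \<alpha> \<beta>"
    using h by (simp add: hom_fibre_iff)
  have l: "lift P u \<alpha> \<in> hom (tot P) (on_obj (reindex P u) \<alpha>) \<alpha>"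
    using u objs(1) by (rule lift_hom)
  \<comment> \<open>Since \<open>h\<close> is vertical, its composite with the lift still lies over
    \<open>u\<close>; this is what allows it to be factored through the lift at
    \<open>\<beta>\<close>.\<close>
  have "on_arr (proj P) (h \<cdot>\<^bsub>tot P\<^esub> lift P u \<alpha>) = ident (base P) (tgt (base P) u) \<cdot>\<^bsub>base P\<^esub> u"
    using p.on_arr_comp[OF l hE] h proj_lift[OF u objs(1)] by (simp add: hom_fibre_iff)
  also have "\<dots> = u"
    using u p.D.ident_comp by (auto simp: hom_def)
  finally have "factor P (lift P u \<beta>) (h \<cdot>\<^bsub>tot P\<^esub> lift P u \<alpha>) (ident (base P) (src (base P) u))
    \<in> hom (fibre P (src (base P) u)) (on_obj (reindex P u) \<alpha>) (on_obj (reindex P u) \<beta>)"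
    using factor_lift_hom[OF u objs(2) p.C.comp_hom[OF l hE] reindex_obj[OF u objs(1)]] by simp
  moreover have "src (tot P) h = \<alpha>" "tgt (tot P) h = \<beta>"
    using hE by (auto simp: hom_def)
  ultimately show ?thesis
    by (simp add: reindex_def)
qed

text \<open>The lift along \<open>t\<close> followed by the lift along \<open>g\<close> lies over
  the composite of \<open>g\<close> with \<open>t\<close>, hence factors vertically through the
  single lift over that composite.\<close>

lemma reindex_comp_iso_hom:
  assumes g: "g \<in> arr (base P)" and t: "t \<in> arr (base P)" "tgt (base P) t = src (base P) g"
    and X: "X \<in> obj (fibre P (tgt (base P) g))"
  shows "reindex_comp_iso P g t X \<in> hom (fibre P (src (base P) t))
    (on_obj (reindex P t) (on_obj (reindex P g) X)) (on_obj (reindex P (g \<cdot>\<^bsub>base P\<^esub> t)) X)"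
proof -
  have Y: "on_obj (reindex P g) X \<in> obj (fibre P (tgt (base P) t))"
    using reindex_obj[OF g X] t by simp
  have l: "lift P g X \<in> hom (tot P) (on_obj (reindex P g) X) X"
    using g X by (rule lift_hom)
  have l': "lift P t (on_obj (reindex P g) X) \<in> hom (tot P)
      (on_obj (reindex P t) (on_obj (reindex P g) X)) (on_obj (reindex P g) X)"
    using t(1) Y by (rule lift_hom)
  have gt: "g \<cdot>\<^bsub>base P\<^esub> t \<in> hom (base P) (src (base P) t) (tgt (base P) g)"
    using g t by (intro p.D.comp_hom) (auto simp: hom_def)
  have pr: "on_arr (proj P) (lift P g X \<cdot>\<^bsub>tot P\<^esub> lift P t (on_obj (reindex P g) X)) = g \<cdot>\<^bsub>base P\<^esub> t"
    using p.on_arr_comp[OF l' l] proj_lift[OF g X] proj_lift[OF t(1) Y] by simp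
  have "src (base P) (g \<cdot>\<^bsub>base P\<^esub> t) = src (base P) t" "tgt (base P) (g \<cdot>\<^bsub>base P\<^esub> t) = tgt (base P) g"
      "g \<cdot>\<^bsub>base P\<^esub> t \<in> arr (base P)"
    using gt by (auto simp: hom_def)
  then show ?thesis
    using factor_lift_hom[OF _ _ p.C.comp_hom[OF l' l] _ pr] reindex_obj[OF t(1) Y] X
    by (simp add: reindex_comp_iso_def)
qed

section \<open>Reindexing along an identity\<close>

lemma lift_ident_hom:
  assumes "\<alpha> \<in> obj (fibre P A)"
  shows "lift P (ident (base P) A) \<alpha>
    \<in> hom (fibre P A) (on_obj (reindex P (ident (base P) A)) \<alpha>) \<alpha>"
proof -
  have "ident (base P) A \<in> arr (base P)" "src (base P) (ident (base P) A) = A"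
    "tgt (base P) (ident (base P) A) = A"
    using assms fibre_base_obj p.D.ident_hom by (auto simp: hom_def)
  then show ?thesis
    using assms lift_hom[of "ident (base P) A" \<alpha>] proj_lift[of "ident (base P) A" \<alpha>]
      reindex_obj[of "ident (base P) A" \<alpha>]
    by (auto simp: hom_fibre_iff obj_fibre_iff)
qed

text \<open>The lift is cartesian over an identity, so the identity of \<open>\<alpha>\<close>
  itself factors through it; the factor is \<open>k\<close>.\<close>

lemma lift_ident_right_inverse:
  assumes "\<alpha> \<in> obj (fibre P A)"
  obtains k where "k \<in> hom (fibre P A) \<alpha> (on_obj (reindex P (ident (base P) A)) \<alpha>)"
    and "lift P (ident (base P) A) \<alpha> \<cdot>\<^bsub>tot P\<^esub> k = ident (tot P) \<alpha>"
proof -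
  let ?i = "ident (base P) A" and ?a = "on_obj (reindex P (ident (base P) A)) \<alpha>"
  let ?l = "lift P ?i \<alpha>"
  have i: "?i \<in> arr (base P)" "src (base P) ?i = A" "tgt (base P) ?i = A"
    using assms fibre_base_obj p.D.ident_hom by (auto simp: hom_def)
  note l = lift_ident_hom[OF assms]
  have src_l: "src (tot P) ?l = ?a"
    using l by (simp add: hom_fibre_iff) (simp add: hom_def)
  have idE: "ident (tot P) \<alpha> \<in> hom (tot P) \<alpha> \<alpha>" "on_arr (proj P) (ident (tot P) \<alpha>) = ?i"
    using fibre_ident_hom[OF assms] by (auto simp: hom_fibre_iff)
  obtain k where "is_factor P ?l (ident (tot P) \<alpha>) ?i k"
    using lift_factor_unique[of ?i \<alpha>, unfolded i] i assms idE by blast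
  moreover have "src (tot P) (ident (tot P) \<alpha>) = \<alpha>"
    using idE(1) by (simp add: hom_def)
  ultimately have k: "k \<in> hom (fibre P A) \<alpha> ?a" and lk: "?l \<cdot>\<^bsub>tot P\<^esub> k = ident (tot P) \<alpha>"
    using src_l assms fibre_hom_objs(1)[OF l]
    by (auto simp: is_factor_def hom_fibre_iff obj_fibre_iff)
  then show ?thesis
    by (rule that)
qed

text \<open>Let \<open>?l\<close> be the lift over the identity and \<open>k\<close> its right
  inverse. Precomposing with \<open>?l\<close> takes splittings of \<open>h\<close> to splittings of
  \<open>h\<close> after \<open>?l\<close>, and precomposing with \<open>k\<close> leads back, so
  existence and uniqueness both transfer. The assumption \<open>units\<close> types the restricted
  units, as associativity requires; \<open>section_unit_hom\<close> supplies it once coproducts are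
  available.\<close>

lemma quantifier_splitting_reindex_ident:
  assumes \<alpha>: "\<alpha> \<in> obj (fibre P A)"
    and units: "\<And>u g \<beta>. \<lbrakk>u \<in> F; tgt (base P) u = A; is_section (base P) u g;
        \<beta> \<in> obj (fibre P (src (base P) u))\<rbrakk>
      \<Longrightarrow> section_unit P Q u g \<beta>
        \<in> hom (fibre P A) (on_obj (reindex P g) \<beta>) (on_obj (coprod Q u) \<beta>)"
    and split: "quantifier_splitting P F Q A (on_obj (reindex P (ident (base P) A)) \<alpha>)"
  shows "quantifier_splitting P F Q A \<alpha>"
  unfolding quantifier_splitting_def
proof (intro ballI impI)
  fix u \<beta> h
  assume u: "u \<in> F" "tgt (base P) u = A" and \<beta>: "\<beta> \<in> obj (fibre P (src (base P) u))"
    and h: "h \<in> hom (fibre P A) \<alpha> (on_obj (coprod Q u) \<beta>)"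
  let ?a = "on_obj (reindex P (ident (base P) A)) \<alpha>" and ?l = "lift P (ident (base P) A) \<alpha>"
  let ?splits = "\<lambda>\<alpha> h g h'. is_section (base P) u g \<and> h' \<in> hom (fibre P A) \<alpha> (on_obj (reindex P g) \<beta>)
    \<and> h = section_unit P Q u g \<beta> \<cdot>\<^bsub>tot P\<^esub> h'"
  note l = lift_ident_hom[OF \<alpha>]
  obtain k where k: "k \<in> hom (fibre P A) \<alpha> ?a" and lk: "?l \<cdot>\<^bsub>tot P\<^esub> k = ident (tot P) \<alpha>"
    using \<alpha> by (rule lift_ident_right_inverse)
  have hl: "h \<cdot>\<^bsub>tot P\<^esub> ?l \<in> hom (fibre P A) ?a (on_obj (coprod Q u) \<beta>)"
    using l h by (rule fibre_comp_hom)
  have ex1: "\<exists>!d. case d of (g, h') \<Rightarrow> ?splits ?a (h \<cdot>\<^bsub>tot P\<^esub> ?l) g h'"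
    using split u \<beta> hl unfolding quantifier_splitting_def by blast
  have to_reindex: "?splits ?a (h \<cdot>\<^bsub>tot P\<^esub> ?l) g (h' \<cdot>\<^bsub>tot P\<^esub> ?l)" if s: "?splits \<alpha> h g h'" for g h'
  proof -
    have h': "h' \<in> hom (fibre P A) \<alpha> (on_obj (reindex P g) \<beta>)" and sec: "is_section (base P) u g"
      and eq: "h = section_unit P Q u g \<beta> \<cdot>\<^bsub>tot P\<^esub> h'"
      using s by blast+
    show ?thesis
      using sec fibre_comp_hom[OF l h'] fibre_comp_assoc[OF l h' units[OF u sec \<beta>]] eq by simp
  qed
  have hlk: "(h \<cdot>\<^bsub>tot P\<^esub> ?l) \<cdot>\<^bsub>tot P\<^esub> k = h"
    using fibre_comp_assoc[OF k l h] lk fibre_comp_ident(1)[OF h] by simp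
  have from_reindex: "?splits \<alpha> h g (h' \<cdot>\<^bsub>tot P\<^esub> k)" if s: "?splits ?a (h \<cdot>\<^bsub>tot P\<^esub> ?l) g h'" for g h'
  proof -
    have h': "h' \<in> hom (fibre P A) ?a (on_obj (reindex P g) \<beta>)" and sec: "is_section (base P) u g"
      and eq: "h \<cdot>\<^bsub>tot P\<^esub> ?l = section_unit P Q u g \<beta> \<cdot>\<^bsub>tot P\<^esub> h'"
      using s by blast+
    have "h = section_unit P Q u g \<beta> \<cdot>\<^bsub>tot P\<^esub> (h' \<cdot>\<^bsub>tot P\<^esub> k)"
      using fibre_comp_assoc[OF k h' units[OF u sec \<beta>]] hlk unfolding eq by simp
    with sec fibre_comp_hom[OF k h'] show ?thesis
      by blast
  qed
  \<comment> \<open>Precomposition with \<open>?l\<close> is injective on vertical arrows out of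
    \<open>\<alpha>\<close>, because \<open>k\<close> undoes it.\<close>
  have cancel: "h' = (h' \<cdot>\<^bsub>tot P\<^esub> ?l) \<cdot>\<^bsub>tot P\<^esub> k" if "h' \<in> hom (fibre P A) \<alpha> \<gamma>" for h' \<gamma>
    using fibre_comp_assoc[OF k l that] lk fibre_comp_ident(1)[OF that] by simp
  from ex1 obtain g h' where s: "?splits ?a (h \<cdot>\<^bsub>tot P\<^esub> ?l) g h'"
    and uniq: "\<And>g2 h2. ?splits ?a (h \<cdot>\<^bsub>tot P\<^esub> ?l) g2 h2 \<Longrightarrow> g2 = g \<and> h2 = h'"
    unfolding ex1_pair_iff by blast
  \<comment> \<open>A competing splitting of \<open>h\<close> is moved to the reindexed object,
    where uniqueness applies, and is then recovered by \<open>cancel\<close>.\<close>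
  have "g2 = g \<and> h2 = h' \<cdot>\<^bsub>tot P\<^esub> k" if s2: "?splits \<alpha> h g2 h2" for g2 h2
  proof -
    have "g2 = g" "h2 \<cdot>\<^bsub>tot P\<^esub> ?l = h'"
      using uniq[OF to_reindex[OF s2]] by blast+
    then show ?thesis
      using s2 cancel by blast
  qed
  then show "\<exists>!d. case d of (g, h') \<Rightarrow> ?splits \<alpha> h g h'"
    using from_reindex[OF s] unfolding ex1_pair_iff by blast
qed

section \<open>Coproducts and their units restricted along sections\<close>

context
  fixes F :: "'ba set" and Q :: "('eo, 'ea, 'ba) coprod_data"
  assumes F_arr: "F \<subseteq> arr (base P)"
    and coprods: "fibred_coproducts P F Q"
begin

lemma coprod_obj:
  assumes "g \<in> F" "\<beta> \<in> obj (fibre P (src (base P) g))"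
  shows "on_obj (coprod Q g) \<beta> \<in> obj (fibre P (tgt (base P) g))"
proof -
  interpret adjunction "fibre P (src (base P) g)" "fibre P (tgt (base P) g)"
    "coprod Q g" "reindex P g" "coprod_unit Q g" "coprod_counit Q g"
    using coprods assms(1) by (simp add: fibred_coproducts_def)
  show ?thesis
    using assms(2) by (rule L.on_obj_obj)
qed

lemma coprod_unit_hom:
  assumes "g \<in> F" "\<beta> \<in> obj (fibre P (src (base P) g))"
  shows "coprod_unit Q g \<beta> \<in> hom (fibre P (src (base P) g))
    \<beta> (on_obj (reindex P g) (on_obj (coprod Q g) \<beta>))"
proof -
  interpret adjunction "fibre P (src (base P) g)" "fibre P (tgt (base P) g)"
    "coprod Q g" "reindex P g" "coprod_unit Q g" "coprod_counit Q g"
    using coprods assms(1) by (simp add: fibred_coproducts_def)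
  show ?thesis
    using unit.component[OF assms(2)] by (simp add: id_ftor_def comp_ftor_def)
qed

text \<open>Three vertical arrows are composed: the reindexed unit, the comparison with reindexing
  along the composite of \<open>g\<close> and \<open>t\<close>, and the lift over an identity. The
  last two fit together because \<open>t\<close> is a section, so that the composite is this very
  identity.\<close>

lemma section_unit_hom:
  assumes g: "g \<in> F" and t: "is_section (base P) g t" and \<beta>: "\<beta> \<in> obj (fibre P (src (base P) g))"
  shows "section_unit P Q g t \<beta> \<in> hom (fibre P (tgt (base P) g))
    (on_obj (reindex P t) \<beta>) (on_obj (coprod Q g) \<beta>)"
proof -
  have tB: "t \<in> arr (base P)" "src (base P) t = tgt (base P) g" "tgt (base P) t = src (base P) g"
    "g \<cdot>\<^bsub>base P\<^esub> t = ident (base P) (tgt (base P) g)"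
    using t by (auto simp: is_section_def hom_def)
  have gB: "g \<in> arr (base P)"
    using g F_arr by blast
  note X = coprod_obj[OF g \<beta>]
  show ?thesis
    unfolding section_unit_def section_iso_def
    using reindex_hom[of t] reindex_comp_iso_hom[OF gB tB(1,3) X] coprod_unit_hom[OF g \<beta>]
      lift_ident_hom[OF X] tB
    by (auto intro!: fibre_comp_hom)
qed

text \<open>From left to right, the reindexing arrow is taken to be an identity and the result is
  carried back along the lift. From right to left, a reindexed object again lies in a fibre and so
  is splitting by hypothesis.\<close>

lemma quantifier_free_iff_splitting:
  "(\<forall>A\<in>obj (base P). \<forall>\<alpha>\<in>obj (fibre P A). quantifier_free P F Q A \<alpha>)
    \<longleftrightarrow> (\<forall>A. \<forall>\<alpha>\<in>obj (fibre P A). quantifier_splitting P F Q A \<alpha>)"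
    (is "?free \<longleftrightarrow> ?split")
proof
  assume free: ?free
  show ?split
  proof (intro allI ballI)
    fix A \<alpha>
    assume \<alpha>: "\<alpha> \<in> obj (fibre P A)"
    then have "ident (base P) A \<in> hom (base P) A A" "quantifier_free P F Q A \<alpha>"
      using free fibre_base_obj p.D.ident_hom by blast+
    then have "quantifier_splitting P F Q A (on_obj (reindex P (ident (base P) A)) \<alpha>)"
      by (auto simp: quantifier_free_def hom_def)
    with \<alpha> show "quantifier_splitting P F Q A \<alpha>"
      using section_unit_hom by (blast intro: quantifier_splitting_reindex_ident)
  qed
next
  assume ?split
  then show ?free
    using reindex_obj by (auto simp: quantifier_free_def)
qed

section \<open>Splittings and epsilon families\<close>

text \<open>The third condition of an epsilon family is exactly the uniqueness of a splitting. The
  object \<open>\<alpha>\<close> may be arbitrary, since any vertical \<open>h\<close> out of it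
  already places it in the fibre over \<open>A\<close>.\<close>

lemma epsilon_family_splits:
  assumes fam: "epsilon_family P F Q \<epsilon> \<epsilon>'"
  shows "quantifier_splitting P F Q A \<alpha>"
  unfolding quantifier_splitting_def
proof (intro ballI impI)
  fix u \<beta> h
  assume u: "u \<in> F" "tgt (base P) u = A" and \<beta>: "\<beta> \<in> obj (fibre P (src (base P) u))"
    and h: "h \<in> hom (fibre P A) \<alpha> (on_obj (coprod Q u) \<beta>)"
  have sec: "is_section (base P) u (\<epsilon> \<beta> u)"
    and \<epsilon>': "\<epsilon>' \<beta> u \<in> hom (fibre P A) (on_obj (coprod Q u) \<beta>) (on_obj (reindex P (\<epsilon> \<beta> u)) \<beta>)"
    and eq: "section_unit P Q u (\<epsilon> \<beta> u) \<beta> \<cdot>\<^bsub>tot P\<^esub> \<epsilon>' \<beta> u = ident (tot P) (on_obj (coprod Q u) \<beta>)"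
    using fam u \<beta> by (auto simp: epsilon_family_def is_section_def)
  \<comment> \<open>Reassociating exposes the second condition: the first two factors compose to an
    identity, leaving \<open>h\<close>.\<close>
  have "section_unit P Q u (\<epsilon> \<beta> u) \<beta> \<cdot>\<^bsub>tot P\<^esub> (\<epsilon>' \<beta> u \<cdot>\<^bsub>tot P\<^esub> h) = h"
    using fibre_comp_assoc[OF h \<epsilon>' section_unit_hom[OF u(1) sec \<beta>, unfolded u(2)]] eq
      fibre_comp_ident(2)[OF h]
    by simp
  moreover have "\<epsilon>' \<beta> u \<cdot>\<^bsub>tot P\<^esub> h \<in> hom (fibre P A) \<alpha> (on_obj (reindex P (\<epsilon> \<beta> u)) \<beta>)"
    using h \<epsilon>' by (rule fibre_comp_hom)
  moreover have "t = \<epsilon> \<beta> u \<and> h' = \<epsilon>' \<beta> u \<cdot>\<^bsub>tot P\<^esub> h"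
    if "is_section (base P) u t" "h' \<in> hom (fibre P A) \<alpha> (on_obj (reindex P t) \<beta>)"
      "h = section_unit P Q u t \<beta> \<cdot>\<^bsub>tot P\<^esub> h'" for t h'
    using fam u \<beta> h that fibre_hom_objs(1)[OF h] unfolding epsilon_family_def by blast
  ultimately show "\<exists>!d. case d of (g, h') \<Rightarrow> is_section (base P) u g
      \<and> h' \<in> hom (fibre P A) \<alpha> (on_obj (reindex P g) \<beta>)
      \<and> h = section_unit P Q u g \<beta> \<cdot>\<^bsub>tot P\<^esub> h'"
    using sec unfolding ex1_pair_iff by metis
qed

text \<open>The first two conditions come from choosing, at each index, a splitting of the identity
  of the coproduct; the third comes from uniqueness of the splittings of all other vertical
  arrows.\<close>

lemma splitting_epsilon_family:
  assumes split: "\<And>A \<alpha>. \<alpha> \<in> obj (fibre P A) \<Longrightarrow> quantifier_splitting P F Q A \<alpha>"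
  shows "\<exists>\<epsilon> \<epsilon>'. epsilon_family P F Q \<epsilon> \<epsilon>'"
proof -
  let ?splits = "\<lambda>u \<beta> \<gamma> h g h'. is_section (base P) u g
    \<and> h' \<in> hom (fibre P (tgt (base P) u)) \<gamma> (on_obj (reindex P g) \<beta>)
    \<and> h = section_unit P Q u g \<beta> \<cdot>\<^bsub>tot P\<^esub> h'"
  have ex1: "\<exists>!d. case d of (g, h') \<Rightarrow> ?splits u \<beta> \<gamma> h g h'"
    if "u \<in> F" "\<beta> \<in> obj (fibre P (src (base P) u))"
      "h \<in> hom (fibre P (tgt (base P) u)) \<gamma> (on_obj (coprod Q u) \<beta>)" for u \<beta> \<gamma> h
    using split[OF fibre_hom_objs(1)[OF that(3)]] that unfolding quantifier_splitting_def by blast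
  have uniq: "g = g2 \<and> h' = h2"
    if "u \<in> F" "\<beta> \<in> obj (fibre P (src (base P) u))"
      "h \<in> hom (fibre P (tgt (base P) u)) \<gamma> (on_obj (coprod Q u) \<beta>)"
      "?splits u \<beta> \<gamma> h g h'" "?splits u \<beta> \<gamma> h g2 h2" for u \<beta> \<gamma> h g h' g2 h2
    using ex1[OF that(1-3), unfolded ex1_pair_iff] that(4,5) by blast
  \<comment> \<open>Section and vertical arrow are packed into one \<open>d\<close>, so that a
    single use of choice selects a matching pair at every index.\<close>
  have "\<exists>d. ?splits u \<beta> (on_obj (coprod Q u) \<beta>) (ident (tot P) (on_obj (coprod Q u) \<beta>)) (fst d) (snd d)"
    if "u \<in> F" "\<beta> \<in> obj (fibre P (src (base P) u))" for u \<beta>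
    using ex1[OF that fibre_ident_hom[OF coprod_obj[OF that]], unfolded ex1_pair_iff]
    unfolding split_paired_Ex fst_conv snd_conv by blast
  then obtain d where d: "\<And>u \<beta>. \<lbrakk>u \<in> F; \<beta> \<in> obj (fibre P (src (base P) u))\<rbrakk> \<Longrightarrow>
      ?splits u \<beta> (on_obj (coprod Q u) \<beta>) (ident (tot P) (on_obj (coprod Q u) \<beta>))
        (fst (d u \<beta>)) (snd (d u \<beta>))"
    by metis
  define \<epsilon> where "\<epsilon> \<beta> u = fst (d u \<beta>)" for \<beta> u
  define \<epsilon>' where "\<epsilon>' \<beta> u = snd (d u \<beta>)" for \<beta> u
  have id: "?splits u \<beta> (on_obj (coprod Q u) \<beta>) (ident (tot P) (on_obj (coprod Q u) \<beta>)) (\<epsilon> \<beta> u) (\<epsilon>' \<beta> u)"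
    if "u \<in> F" "\<beta> \<in> obj (fibre P (src (base P) u))" for u \<beta>
    unfolding \<epsilon>_def \<epsilon>'_def using d[OF that] .
  \<comment> \<open>Precomposing the chosen splitting of the identity with \<open>h\<close> gives
    the splitting of \<open>h\<close> against which every other one is compared.\<close>
  have all: "?splits u \<beta> \<gamma> h (\<epsilon> \<beta> u) (\<epsilon>' \<beta> u \<cdot>\<^bsub>tot P\<^esub> h)"
    if u: "u \<in> F" and \<beta>: "\<beta> \<in> obj (fibre P (src (base P) u))"
      and h: "h \<in> hom (fibre P (tgt (base P) u)) \<gamma> (on_obj (coprod Q u) \<beta>)" for u \<beta> \<gamma> h
  proof -
    have sec: "is_section (base P) u (\<epsilon> \<beta> u)"
      and \<epsilon>': "\<epsilon>' \<beta> u \<in> hom (fibre P (tgt (base P) u))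
        (on_obj (coprod Q u) \<beta>) (on_obj (reindex P (\<epsilon> \<beta> u)) \<beta>)"
      and eq: "section_unit P Q u (\<epsilon> \<beta> u) \<beta> \<cdot>\<^bsub>tot P\<^esub> \<epsilon>' \<beta> u = ident (tot P) (on_obj (coprod Q u) \<beta>)"
      using id[OF u \<beta>] by simp_all
    have "h = section_unit P Q u (\<epsilon> \<beta> u) \<beta> \<cdot>\<^bsub>tot P\<^esub> (\<epsilon>' \<beta> u \<cdot>\<^bsub>tot P\<^esub> h)"
      using fibre_comp_assoc[OF h \<epsilon>' section_unit_hom[OF u sec \<beta>]] eq fibre_comp_ident(2)[OF h]
      by simp
    with sec fibre_comp_hom[OF h \<epsilon>'] show ?thesis
      by blast
  qed
  have "epsilon_family P F Q \<epsilon> \<epsilon>'"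
    unfolding epsilon_family_def
  proof (intro conjI ballI allI impI)
    fix g \<beta> \<gamma> u t h
    assume g: "g \<in> F" "\<beta> \<in> obj (fibre P (src (base P) g))"
      "u \<in> hom (fibre P (tgt (base P) g)) \<gamma> (on_obj (coprod Q g) \<beta>)"
      and s: "?splits g \<beta> \<gamma> u t h"
    show "t = \<epsilon> \<beta> g" "h = \<epsilon>' \<beta> g \<cdot>\<^bsub>tot P\<^esub> u"
      using uniq[OF g s all[OF g]] by auto
  \<comment> \<open>The conditions on the values of the family at each index are the components of
    \<open>id\<close>.\<close>
  qed (use id in \<open>auto simp: is_section_def\<close>)
  then show ?thesis
    by blast
qed

text \<open>The comparison is made at genuine indices, the only places where the conditions
  constrain the values.\<close>

lemma epsilon_family_unique:
  assumes \<epsilon>: "epsilon_family P F Q \<epsilon> \<epsilon>'" and \<delta>: "epsilon_family P F Q \<delta> \<delta>'"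
    and f: "f \<in> F" and \<alpha>: "\<alpha> \<in> obj (fibre P (src (base P) f))"
  shows "\<delta> \<alpha> f = \<epsilon> \<alpha> f" "\<delta>' \<alpha> f = \<epsilon>' \<alpha> f"
proof -
  let ?X = "on_obj (coprod Q f) \<alpha>"
  note X = coprod_obj[OF f \<alpha>]
  have "\<epsilon>' \<alpha> f \<in> hom (fibre P (tgt (base P) f)) ?X (on_obj (reindex P (\<epsilon> \<alpha> f)) \<alpha>)"
    using \<epsilon> f \<alpha> by (simp add: epsilon_family_def)
  note \<epsilon>'_ident = fibre_comp_ident(1)[OF this]
  have "is_section (base P) f (\<delta> \<alpha> f)
      \<and> \<delta>' \<alpha> f \<in> hom (fibre P (tgt (base P) f)) ?X (on_obj (reindex P (\<delta> \<alpha> f)) \<alpha>)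
      \<and> ident (tot P) ?X = section_unit P Q f (\<delta> \<alpha> f) \<alpha> \<cdot>\<^bsub>tot P\<^esub> \<delta>' \<alpha> f"
    using \<delta> f \<alpha> by (simp add: epsilon_family_def is_section_def)
  \<comment> \<open>The third condition for \<open>\<epsilon>\<close> is used with \<open>u\<close>
    the identity of \<open>?X\<close>, decomposed by the pair coming from
    \<open>\<delta>\<close>.\<close>
  then have "\<delta> \<alpha> f = \<epsilon> \<alpha> f \<and> \<delta>' \<alpha> f = \<epsilon>' \<alpha> f \<cdot>\<^bsub>tot P\<^esub> ident (tot P) ?X"
    using \<epsilon> f \<alpha> X fibre_ident_hom[OF X] unfolding epsilon_family_def by blast
  then show "\<delta> \<alpha> f = \<epsilon> \<alpha> f" "\<delta>' \<alpha> f = \<epsilon>' \<alpha> f"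
    using \<epsilon>'_ident by auto
qed

end

end

theorem theorem4p11:
  fixes P :: "('eo, 'ea, 'bo, 'ba) fibration_data"
    and F :: "'ba set"
    and Q :: "('eo, 'ea, 'ba) coprod_data"
  assumes "display_map_category (base P) F"
    and "has_dependent_coproducts (base P) F"
    and "cloven_fibration P"
    and "fibred_coproducts P F Q"
  shows "dependent_Hilbert_epsilon_fibration P F Q \<longleftrightarrow>
    (\<exists>\<epsilon> \<epsilon>'. epsilon_family P F Q \<epsilon> \<epsilon>' \<and>
       (\<forall>\<delta> \<delta>'. epsilon_family P F Q \<delta> \<delta>' \<longrightarrow>
          (\<forall>f\<in>F. \<forall>\<alpha>\<in>obj (fibre P (src (base P) f)). \<delta> \<alpha> f = \<epsilon> \<alpha> f \<and> \<delta>' \<alpha> f = \<epsilon>' \<alpha> f)))"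
proof -
  have F: "F \<subseteq> arr (base P)"
    using assms(1) by (simp add: display_map_category_def)
  \<comment> \<open>These are the assumptions of the two nested contexts, in the order in which the
    exported lemmas take them.\<close>
  note ctx = assms(3) F assms(4)
  have "dependent_Hilbert_epsilon_fibration P F Q
      \<longleftrightarrow> (\<forall>A. \<forall>\<alpha>\<in>obj (fibre P A). quantifier_splitting P F Q A \<alpha>)"
    using assms quantifier_free_iff_splitting[OF ctx]
    by (simp add: dependent_Hilbert_epsilon_fibration_def)
  also have "\<dots> \<longleftrightarrow> (\<exists>\<epsilon> \<epsilon>'. epsilon_family P F Q \<epsilon> \<epsilon>')"
    using epsilon_family_splits[OF ctx] splitting_epsilon_family[OF ctx] by blast
  \<comment> \<open>Any two families agree at all indices, so the uniqueness clause follows from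
    existence alone.\<close>
  finally show ?thesis
    using epsilon_family_unique[OF ctx] by blast
qed

end
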